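(* Let $(f,\bar{f}) \colon (G,P_G) \rightarrow (H,P_H)$ be a morphism in $\mathsf{PreOrdGrp}$ and denote by $S$ the normal closure of $\bar{f}(P_G)$ in $H$, i.e. $$S = \{s_1 - s_2 + \cdots - s_n \mid s_i = h_i + f(g_i) - h_i, \ \text{with } h_i \in H \text{ and } g_i \in P_G, \text{ for any } i \in \{1,\dots,n\}\}.$$ Let $q \colon H \twoheadrightarrow H/S$ be the quotient morphism. Then the arrow $$(q,\bar{q}) \colon (H,P_H) \twoheadrightarrow (H/S,q(P_H))$$ is a $\mathscr{Z}$-cokernel of $(f,\bar{f})$ in $\mathsf{PreOrdGrp}$.
   Context: Groups and monoids are written additively but need not be commutative. $\mathsf{PreOrdGrp}$ is the category of preordered groups: objects are pairs $(G,P_G)$ with $G$ a group and $P_G$ a submonoid of $G$ closed under conjugation in $G$ (the positive cone); a morphism $(f,\bar f)\colon (G,P_G)\to(H,P_H)$ is a group morphism $f\colon G\to H$ with $f(P_G)\subseteq P_H$, and $\bar f\colon P_G\to P_H$ is its restriction. $\mathscr{Z}$ is the class of preordered groups $(G,P_G)$ with $P_G=0$. A morphism is $\mathscr{Z}$-trivial if it factors through an object of $\mathscr{Z}$. A morphism $q\colon C\to Q$ is a $\mathscr{Z}$-cokernel of $k\colon B\to C$ if $q\cdot k$ is $\mathscr{Z}$-trivial and, for every $\beta\colon C\to Y$ such that $\beta\cdot k$ is $\mathscr{Z}$-trivial, there is a unique $\psi\colon Q\to Y$ with $\psi\cdot q=\beta$. *)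

theory Defs
  imports HOL.Hull "HOL-Algebra.Coset"
begin

text \<open>
  Groups are those of HOL-Algebra, hence written multiplicatively.
  An object of PreOrdGrp is a pair of a group and its positive cone.
\<close>

type_synonym 'a preord_grp = "'a monoid \<times> 'a set"

definition preord_group :: "'a preord_grp \<Rightarrow> bool" where
  "preord_group X \<longleftrightarrow> (case X of (G, P) \<Rightarrow>
     group G \<and> submonoid P G \<and>
     (\<forall>g\<in>carrier G. \<forall>p\<in>P. g \<otimes>\<^bsub>G\<^esub> p \<otimes>\<^bsub>G\<^esub> inv\<^bsub>G\<^esub> g \<in> P))"

text \<open>
  Morphisms are required to be extensional on the carrier of the domain, so that
  equality of HOL functions is equality of morphisms; composition is the library's
  \<open>compose\<close>. The restriction to the positive cones is determined by the group
  morphism and is not carried along.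
\<close>

definition preord_hom :: "'a preord_grp \<Rightarrow> 'b preord_grp \<Rightarrow> ('a \<Rightarrow> 'b) set" where
  "preord_hom X Y = {f. preord_group X \<and> preord_group Y \<and>
     f \<in> hom (fst X) (fst Y) \<and> f \<in> extensional (carrier (fst X)) \<and>
     f ` snd X \<subseteq> snd Y}"

definition trivial_cone :: "'a preord_grp \<Rightarrow> bool" where
  "trivial_cone X \<longleftrightarrow> preord_group X \<and> snd X = {\<one>\<^bsub>fst X\<^esub>}"

definition factors_through ::
    "'a preord_grp \<Rightarrow> 'b preord_grp \<Rightarrow> ('a \<Rightarrow> 'b) \<Rightarrow> 'n preord_grp \<Rightarrow> bool" where
  "factors_through X Y f N \<longleftrightarrow>
     (\<exists>u\<in>preord_hom X N. \<exists>v\<in>preord_hom N Y. f = compose (carrier (fst X)) v u)"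

text \<open>
  HOL cannot quantify existentially over the type of the intermediate object, so it
  is taken over the element type of the codomain. The lemma \<open>Z_trivialI\<close>
  below shows that this loses nothing: a factorization through an object with trivial
  cone over any type whatsoever yields one over the type of the codomain.
\<close>

definition Z_trivial :: "'a preord_grp \<Rightarrow> 'b preord_grp \<Rightarrow> ('a \<Rightarrow> 'b) \<Rightarrow> bool" where
  "Z_trivial X Y f \<longleftrightarrow> f \<in> preord_hom X Y \<and>
     (\<exists>N :: 'b preord_grp. trivial_cone N \<and> factors_through X Y f N)"

text \<open>
  The test objects \<open>Y\<close> range over all preordered groups with elements in the
  type given by the first argument; a theorem that leaves this type variable free
  covers all test objects.
\<close>

definition Z_cokernel ::
    "'y itself \<Rightarrow> 'b preord_grp \<Rightarrow> 'c preord_grp \<Rightarrow> 'q preord_grp \<Rightarrow>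
     ('b \<Rightarrow> 'c) \<Rightarrow> ('c \<Rightarrow> 'q) \<Rightarrow> bool" where
  "Z_cokernel T B C Q k q \<longleftrightarrow>
     k \<in> preord_hom B C \<and> q \<in> preord_hom C Q \<and>
     Z_trivial B Q (compose (carrier (fst B)) q k) \<and>
     (\<forall>(Y :: 'y preord_grp) \<beta>.
        \<beta> \<in> preord_hom C Y \<and> Z_trivial B Y (compose (carrier (fst B)) \<beta> k) \<longrightarrow>
        (\<exists>!\<psi>. \<psi> \<in> preord_hom Q Y \<and> compose (carrier (fst C)) \<psi> q = \<beta>))"

definition normal_closure :: "('a, 'm) monoid_scheme \<Rightarrow> 'a set \<Rightarrow> 'a set" where
  "normal_closure G A = (\<lambda>N. N \<lhd> G) hull A"

text \<open>In additive notation, \<open>s\<^sub>1 - s\<^sub>2 + s\<^sub>3 - \<dots>\<close>:\<close>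

fun alt_prod :: "('a, 'm) monoid_scheme \<Rightarrow> 'a list \<Rightarrow> 'a" where
  "alt_prod G [] = \<one>\<^bsub>G\<^esub>"
| "alt_prod G [s] = s"
| "alt_prod G (s # t # ss) = s \<otimes>\<^bsub>G\<^esub> inv\<^bsub>G\<^esub> t \<otimes>\<^bsub>G\<^esub> alt_prod G ss"

lemma Z_trivialI:
  fixes X :: "'a preord_grp" and Y :: "'b preord_grp" and N :: "'n preord_grp"
  assumes N: "trivial_cone N" and fac: "factors_through X Y f N"
  shows "Z_trivial X Y f"
proof -
  obtain u v where u: "u \<in> preord_hom X N" and v: "v \<in> preord_hom N Y"
    and f: "f = compose (carrier (fst X)) v u"
    using fac unfolding factors_through_def by blast
  obtain G P where X: "X = (G, P)" by (cases X)
  obtain H Q where Y: "Y = (H, Q)" by (cases Y)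
  obtain K R where NK: "N = (K, R)" by (cases N)
  have G: "group G" and PG: "P \<subseteq> carrier G" and H: "group H" and QH: "submonoid Q H"
    and K: "group K" and R: "R = {\<one>\<^bsub>K\<^esub>}"
    using u v N unfolding preord_hom_def preord_group_def trivial_cone_def X Y NK
    by (auto dest: submonoid.subset)
  have uh: "u \<in> hom G K" "u ` P \<subseteq> R" and vh: "v \<in> hom K H"
    using u v unfolding preord_hom_def X Y NK by auto
  have v1: "v \<one>\<^bsub>K\<^esub> = \<one>\<^bsub>H\<^esub>"
    using K H vh by (simp add: hom_one)
  have "v \<circ> u \<in> hom G H"
    using uh(1) vh by (rule hom_compose)
  then have fh: "f \<in> hom G H"
    using G unfolding f X hom_def
    by (auto simp: compose_def Pi_iff group.is_monoid monoid.m_closed)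
  have fP: "f p = \<one>\<^bsub>H\<^esub>" if "p \<in> P" for p
    using that PG uh(2) v1 unfolding f X R by (auto simp: compose_def)
  have fext: "f \<in> extensional (carrier G)"
    unfolding f X by (simp add: compose_extensional)
  let ?N = "(H, {\<one>\<^bsub>H\<^esub>})" and ?i = "\<lambda>h\<in>carrier H. h"
  have poN: "preord_group ?N"
    using H by (auto simp: preord_group_def submonoid_def group.is_monoid
        monoid.m_closed group.r_inv)
  have "f \<in> preord_hom X ?N"
    using fh fP fext poN u unfolding preord_hom_def X by auto
  moreover have "?i \<in> preord_hom ?N Y"
    using poN v H QH unfolding preord_hom_def Y
    by (auto simp: hom_def group.is_monoid monoid.m_closed submonoid.one_closed)
  moreover have "f = compose (carrier (fst X)) ?i f"
    using fh fext unfolding X by (intro ext) (auto simp: compose_def hom_def Pi_iff extensional_def)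
  ultimately have "factors_through X Y f ?N"
    unfolding factors_through_def by blast
  moreover have "trivial_cone ?N"
    using poN by (simp add: trivial_cone_def)
  moreover have "f \<in> preord_hom X Y"
    using fh fP fext u v QH unfolding preord_hom_def X Y
    by (auto simp: submonoid.one_closed)
  ultimately show ?thesis
    unfolding Z_trivial_def by blast
qed

end

theory Submission
  imports Defs
begin

text \<open>
  Since the neutral element is itself a conjugate of an element of \<open>f(P\<^sub>G)\<close>, any signed word in
  such conjugates can be padded to an alternating one of even length, and on these words
  concatenation, reversal and conjugation realise the operations of a normal subgroup.
  For the cokernel, a morphism is \<open>\<Z>\<close>-trivial exactly when it kills the positive cone, so
  \<open>\<beta> \<cdot> f\<close> is \<open>\<Z>\<close>-trivial iff the kernel of \<open>\<beta>\<close> contains the normal closure \<open>S\<close>; the universal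
  property is then that of the quotient group, the cone \<open>q(P\<^sub>H)\<close> being respected automatically.
\<close>

section \<open>Alternating words and normal closures in a group\<close>

context group
begin

lemma alt_prod_mem:
  assumes "subgroup N G" "set ss \<subseteq> N"
  shows "alt_prod G ss \<in> N"
  using assms(2) by (induction ss rule: induct_list012)
    (auto simp: subgroup.one_closed subgroup.m_closed subgroup.m_inv_closed assms(1))

lemmas alt_prod_closed = alt_prod_mem[OF subgroup_self]

text \<open>After an even number of letters the sign pattern starts afresh with a positive sign, so
  the letters of \<open>ts\<close> keep their own signs.\<close>

lemma alt_prod_append:
  assumes "even (length ss)" "set ss \<subseteq> carrier G" "set ts \<subseteq> carrier G"
  shows "alt_prod G (ss @ ts) = alt_prod G ss \<otimes> alt_prod G ts"
  using assms by (induction ss rule: induct_list012) (auto simp: m_assoc alt_prod_closed)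

text \<open>Inversion reverses the order of the pairs \<open>s \<otimes> inv t\<close> and turns
  each into \<open>t \<otimes> inv s\<close>; read letter by letter, this is the reversed word.
  Evenness leaves no letter unpaired.\<close>

lemma inv_alt_prod:
  assumes "even (length ss)" "set ss \<subseteq> carrier G"
  shows "inv (alt_prod G ss) = alt_prod G (rev ss)"
  using assms
  by (induction ss rule: induct_list012)
    (auto simp: m_assoc alt_prod_closed alt_prod_append inv_mult_group)

lemma conj_mult:
  assumes "h \<in> carrier G" "x \<in> carrier G" "y \<in> carrier G"
  shows "h \<otimes> (x \<otimes> y) \<otimes> inv h = (h \<otimes> x \<otimes> inv h) \<otimes> (h \<otimes> y \<otimes> inv h)"
proof -
  have "inv h \<otimes> (h \<otimes> (y \<otimes> inv h)) = y \<otimes> inv h"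
    using assms by (simp flip: m_assoc)
  then show ?thesis
    using assms by (simp add: m_assoc)
qed

text \<open>Conjugation by \<open>h\<close> is an automorphism, so it acts letter by letter and
  respects inverses.\<close>

lemma conj_alt_prod:
  assumes h: "h \<in> carrier G" and "set ss \<subseteq> carrier G"
  shows "h \<otimes> alt_prod G ss \<otimes> inv h = alt_prod G (map (\<lambda>s. h \<otimes> s \<otimes> inv h) ss)"
  using assms(2)
proof (induction ss rule: induct_list012)
  case (3 s t ss)
  have "h \<otimes> inv t \<otimes> inv h = inv (h \<otimes> t \<otimes> inv h)"
    using h 3 by (simp add: inv_mult_group m_assoc)
  then show ?case
    using h 3 by (simp add: conj_mult alt_prod_closed)
qed (use h in auto)

text \<open>\<open>hull\<close> is an intersection, so the point is that normality passes to
  intersections.\<close>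

lemma normal_closure_normal:
  assumes "A \<subseteq> carrier G"
  shows "normal_closure G A \<lhd> G"
proof -
  \<comment> \<open>The whole group is a normal subgroup containing \<open>A\<close>, so the
    intersected family is nonempty.\<close>
  have N: "carrier G \<lhd> G"
    by (rule normal_invI[OF subgroup_self]) auto
  let ?\<N> = "{N. N \<lhd> G \<and> A \<subseteq> N}"
  have "subgroup (\<Inter>?\<N>) G"
    using N assms by (intro subgroups_Inter) (auto dest: normal_imp_subgroup)
  then have "\<Inter>?\<N> \<lhd> G"
    by (rule normal_invI) (auto dest: normal.inv_op_closed2)
  then show ?thesis
    by (simp add: normal_closure_def hull_def)
qed

text \<open>The words form a normal subgroup that contains \<open>A\<close> and lies in every normal
  subgroup containing \<open>A\<close>, which characterises the hull. The assumption
  \<open>\<one> \<in> A\<close> supplies the padding letter.\<close>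

lemma normal_closure_eq_alt_prods:
  assumes A: "A \<subseteq> carrier G" and one: "\<one> \<in> A"
  shows "normal_closure G A = {alt_prod G ss | ss. ss \<noteq> [] \<and> even (length ss) \<and>
           (\<forall>s\<in>set ss. \<exists>h\<in>carrier G. \<exists>a\<in>A. s = h \<otimes> a \<otimes> inv h)}"
proof -
  define C where "C = {h \<otimes> a \<otimes> inv h | h a. h \<in> carrier G \<and> a \<in> A}"
  define T where "T = {alt_prod G ss | ss. ss \<noteq> [] \<and> even (length ss) \<and> set ss \<subseteq> C}"
  have TI: "alt_prod G ss \<in> T" if "ss \<noteq> []" "even (length ss)" "set ss \<subseteq> C" for ss
    using that unfolding T_def by blast
  have TE: "\<exists>ss. x = alt_prod G ss \<and> ss \<noteq> [] \<and> even (length ss) \<and> set ss \<subseteq> C" if "x \<in> T" for x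
    using that unfolding T_def by blast
  have C: "C \<subseteq> carrier G"
    using A unfolding C_def by auto
  have AC: "A \<subseteq> C"
  proof
    fix a assume "a \<in> A"
    moreover from this have "a = \<one> \<otimes> a \<otimes> inv \<one>" using A by auto
    ultimately show "a \<in> C" unfolding C_def by blast
  qed
  \<comment> \<open>Conjugating a conjugate by \<open>k\<close> gives a conjugate by
    \<open>h \<otimes> k\<close>, so letterwise conjugation stays within words over
    \<open>C\<close>.\<close>
  have conj_C: "h \<otimes> c \<otimes> inv h \<in> C" if h: "h \<in> carrier G" and "c \<in> C" for h c
  proof -
    obtain k a where k: "k \<in> carrier G" "a \<in> A" "c = k \<otimes> a \<otimes> inv k"
      using \<open>c \<in> C\<close> unfolding C_def by blast
    moreover have "a \<in> carrier G" using k A by blast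
    ultimately have "h \<otimes> c \<otimes> inv h = (h \<otimes> k) \<otimes> a \<otimes> inv (h \<otimes> k)"
      using h by (simp add: m_assoc inv_mult_group)
    then show ?thesis
      using h k unfolding C_def by blast
  qed
  have "subgroup T G"
  proof
    show "T \<subseteq> carrier G"
      using C alt_prod_closed unfolding T_def by blast
    \<comment> \<open>The empty word is excluded from \<open>T\<close>, so the identity is
      represented by a word of length two.\<close>
    show "\<one> \<in> T"
      using TI[of "[\<one>, \<one>]"] one AC by auto
    fix x assume "x \<in> T"
    then obtain ss where ss: "x = alt_prod G ss" "ss \<noteq> []" "even (length ss)" "set ss \<subseteq> C"
      using TE by blast
    show "inv x \<in> T"
      using TI[of "rev ss"] ss C by (simp add: inv_alt_prod subset_trans)
    fix y assume "y \<in> T"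
    then obtain ts where ts: "y = alt_prod G ts" "ts \<noteq> []" "even (length ts)" "set ts \<subseteq> C"
      using TE by blast
    show "x \<otimes> y \<in> T"
      using TI[of "ss @ ts"] ss ts C by (simp add: alt_prod_append subset_trans)
  qed
  then have T: "T \<lhd> G"
  proof (rule normal_invI)
    fix h x assume h: "h \<in> carrier G" and "x \<in> T"
    then obtain ss where ss: "x = alt_prod G ss" "ss \<noteq> []" "even (length ss)" "set ss \<subseteq> C"
      using TE by blast
    then have "h \<otimes> x \<otimes> inv h = alt_prod G (map (\<lambda>s. h \<otimes> s \<otimes> inv h) ss)"
      using h C by (simp add: conj_alt_prod subset_trans)
    then show "h \<otimes> x \<otimes> inv h \<in> T"
      using TI[of "map (\<lambda>s. h \<otimes> s \<otimes> inv h) ss"] ss conj_C[OF h] by auto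
  qed
  have "A \<subseteq> T"
  proof
    fix a assume a: "a \<in> A"
    then have "a \<in> carrier G"
      using A by blast
    \<comment> \<open>The one-letter word has odd length; appending \<open>\<one>\<close> makes it
      even without changing its value.\<close>
    then show "a \<in> T"
      using TI[of "[a, \<one>]"] one AC a by auto
  qed
  moreover have "T \<subseteq> N" if N: "A \<subseteq> N" "N \<lhd> G" for N
  proof -
    \<comment> \<open>Normality puts the letters into \<open>N\<close>; closure under the group
      operations then puts the words there.\<close>
    have "C \<subseteq> N"
      using N unfolding C_def by (auto intro: normal.inv_op_closed2)
    then show ?thesis
      using N alt_prod_mem[OF normal_imp_subgroup] unfolding T_def by blast
  qed
  ultimately have "normal_closure G A = T"
    unfolding normal_closure_def using T by (intro hull_unique)
  also have "T = {alt_prod G ss | ss. ss \<noteq> [] \<and> even (length ss) \<and>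
           (\<forall>s\<in>set ss. \<exists>h\<in>carrier G. \<exists>a\<in>A. s = h \<otimes> a \<otimes> inv h)}"
    unfolding T_def C_def by (rule Collect_cong) blast
  finally show ?thesis .
qed

end

section \<open>Morphisms of preordered groups and triviality\<close>

lemma preord_groupD:
  assumes "preord_group (G, P)"
  shows "group G" "submonoid P G" "P \<subseteq> carrier G" "\<one>\<^bsub>G\<^esub> \<in> P"
    "\<And>g p. g \<in> carrier G \<Longrightarrow> p \<in> P \<Longrightarrow> g \<otimes>\<^bsub>G\<^esub> p \<otimes>\<^bsub>G\<^esub> inv\<^bsub>G\<^esub> g \<in> P"
  using assms by (auto simp: preord_group_def dest: submonoid.subset submonoid.one_closed)

lemma preord_hom_iff:
  "f \<in> preord_hom (G, P) (H, Q) \<longleftrightarrow> preord_group (G, P) \<and> preord_group (H, Q) \<and>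
     f \<in> hom G H \<and> f \<in> extensional (carrier G) \<and> f ` P \<subseteq> Q"
  by (simp add: preord_hom_def)

lemma preord_hom_compose:
  assumes f: "f \<in> preord_hom (G, P) (H, Q)" and g: "g \<in> preord_hom (H, Q) (K, R)"
  shows "compose (carrier G) g f \<in> preord_hom (G, P) (K, R)"
proof -
  have P: "P \<subseteq> carrier G" and G: "group G"
    using f by (auto simp: preord_hom_iff dest: preord_groupD)
  have "g \<circ> f \<in> hom G K"
    using f g by (auto simp: preord_hom_iff intro: hom_compose)
  then have "compose (carrier G) g f \<in> hom G K"
    using G by (auto simp: hom_def compose_def Pi_iff group.is_monoid monoid.m_closed)
  moreover have "compose (carrier G) g f ` P \<subseteq> R"
    using f g P by (force simp: preord_hom_iff compose_def image_subset_iff)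
  ultimately show ?thesis
    using f g by (simp add: preord_hom_iff compose_extensional)
qed

text \<open>Through a trivial cone, positive elements pass via the identity. Conversely, a morphism
  killing the positive cone factors through its codomain with the cone shrunk to the identity. This
  turns triviality into a condition on kernels.\<close>

lemma Z_trivial_iff:
  assumes f: "f \<in> preord_hom (G, P) (H, Q)"
  shows "Z_trivial (G, P) (H, Q) f \<longleftrightarrow> f ` P \<subseteq> {\<one>\<^bsub>H\<^esub>}"
proof
  assume "Z_trivial (G, P) (H, Q) f"
  then obtain K :: "'b monoid" and R u v where R: "R = {\<one>\<^bsub>K\<^esub>}"
    and u: "u \<in> preord_hom (G, P) (K, R)" and v: "v \<in> preord_hom (K, R) (H, Q)"
    and fu: "f = compose (carrier G) v u"
    by (auto simp: Z_trivial_def factors_through_def trivial_cone_def)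
  have "v \<one>\<^bsub>K\<^esub> = \<one>\<^bsub>H\<^esub>"
    using v by (auto simp: preord_hom_iff dest: preord_groupD intro!: hom_one)
  moreover have "P \<subseteq> carrier G"
    using f by (auto simp: preord_hom_iff dest: preord_groupD)
  ultimately show "f ` P \<subseteq> {\<one>\<^bsub>H\<^esub>}"
    using u unfolding fu R by (auto simp: preord_hom_iff compose_def)
next
  assume fP: "f ` P \<subseteq> {\<one>\<^bsub>H\<^esub>}"
  have G: "preord_group (G, P)" and H: "preord_group (H, Q)"
    using f by (auto simp: preord_hom_iff)
  interpret H: group H
    using H by (rule preord_groupD)
  \<comment> \<open>The second factor \<open>?i\<close> is the identity on elements, cut down to the
    carrier so as to be extensional.\<close>
  let ?N = "(H, {\<one>\<^bsub>H\<^esub>})" and ?i = "\<lambda>h\<in>carrier H. h"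
  have N: "preord_group ?N"
    by (auto simp: preord_group_def submonoid_def H.group_axioms)
  have "f \<in> preord_hom (G, P) ?N"
    using f fP N by (simp add: preord_hom_iff)
  moreover have "?i \<in> preord_hom ?N (H, Q)"
    using N H preord_groupD(4)[OF H] by (auto simp: preord_hom_iff hom_def)
  moreover have "f = compose (carrier G) ?i f"
    using f by (intro ext) (auto simp: preord_hom_iff compose_def hom_def Pi_iff extensional_def)
  ultimately have "factors_through (G, P) (H, Q) f ?N"
    unfolding factors_through_def by auto
  moreover have "trivial_cone ?N"
    using N by (simp add: trivial_cone_def)
  ultimately show "Z_trivial (G, P) (H, Q) f"
    by (rule Z_trivialI[rotated])
qed

section \<open>The quotient preordered group and its universal property\<close>

lemma preord_group_image:
  assumes X: "preord_group (G, P)" and H: "group H"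
    and h: "h \<in> hom G H" and surj: "h ` carrier G = carrier H"
  shows "preord_group (H, h ` P)"
proof -
  note PG = preord_groupD[OF X]
  interpret group_hom G H h
    using PG H h by (simp add: group_hom_def group_hom_axioms_def)
  have "submonoid (h ` P) H"
  proof
    show "h ` P \<subseteq> carrier H" using PG(3) by auto
    show "\<one>\<^bsub>H\<^esub> \<in> h ` P" using PG(4) hom_one by force
    fix x y assume "x \<in> h ` P" "y \<in> h ` P"
    then obtain a b where ab: "a \<in> P" "b \<in> P" "x = h a" "y = h b" by blast
    then have "a \<in> carrier G" "b \<in> carrier G"
      using PG(3) by blast+
    then have "x \<otimes>\<^bsub>H\<^esub> y = h (a \<otimes>\<^bsub>G\<^esub> b)"
      using ab by simp
    then show "x \<otimes>\<^bsub>H\<^esub> y \<in> h ` P"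
      using ab submonoid.m_closed[OF PG(2)] by auto
  qed
  moreover have "y \<otimes>\<^bsub>H\<^esub> p \<otimes>\<^bsub>H\<^esub> inv\<^bsub>H\<^esub> y \<in> h ` P" if "y \<in> carrier H" "p \<in> h ` P" for y p
  proof -
    \<comment> \<open>Surjectivity lifts the conjugating element \<open>y\<close>, so the
      conjugation can be carried out in \<open>G\<close>, where \<open>P\<close> is closed under
      it.\<close>
    from that obtain g a where g: "g \<in> carrier G" "y = h g" and a: "a \<in> P" "p = h a"
      unfolding surj[symmetric] by (elim imageE)
    moreover have "a \<in> carrier G"
      using a(1) PG(3) by blast
    ultimately have "y \<otimes>\<^bsub>H\<^esub> p \<otimes>\<^bsub>H\<^esub> inv\<^bsub>H\<^esub> y = h (g \<otimes>\<^bsub>G\<^esub> a \<otimes>\<^bsub>G\<^esub> inv\<^bsub>G\<^esub> g)"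
      by simp
    then show ?thesis
      using PG(5)[OF g(1) a(1)] by auto
  qed
  ultimately show ?thesis
    using H by (simp add: preord_group_def)
qed

lemma Z_cokernel_normal_closure:
  assumes f: "f \<in> preord_hom (G, P) (H, Q)"
    and S: "S = normal_closure H (f ` P)"
    and q: "q = (\<lambda>h\<in>carrier H. S #>\<^bsub>H\<^esub> h)"
  shows "Z_cokernel TYPE('y) (G, P) (H, Q) (H Mod S, q ` Q) f q"
proof -
  have GP: "preord_group (G, P)" and HQ: "preord_group (H, Q)"
    using f by (auto simp: preord_hom_iff)
  note Qsub = preord_groupD(3)[OF HQ] and Psub = preord_groupD(3)[OF GP]
  interpret H: group H
    using HQ by (rule preord_groupD)
  have fPQ: "f ` P \<subseteq> Q"
    using f by (simp add: preord_hom_iff)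
  then have "S \<lhd> H"
    unfolding S using Qsub by (intro H.normal_closure_normal) auto
  then interpret S: normal S H .
  have fPS: "f ` P \<subseteq> S"
    unfolding S normal_closure_def by (rule hull_subset)
  have q_carrier: "q ` carrier H = carrier (H Mod S)"
    unfolding q by (auto simp: FactGroup_def RCOSETS_def)
  have q_hom: "q \<in> hom H (H Mod S)"
    using S.r_coset_hom_Mod unfolding q by (auto simp: hom_def)
  have HS: "preord_group (H Mod S, q ` Q)"
    using HQ S.factorgroup_is_group q_hom q_carrier by (rule preord_group_image)
  have q_mor: "q \<in> preord_hom (H, Q) (H Mod S, q ` Q)"
    using HQ HS q_hom unfolding preord_hom_iff by (simp add: q)
  \<comment> \<open>The coset of an element of \<open>S\<close> is \<open>S\<close> itself, the
    identity of the quotient.\<close>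
  have "q (f p) = \<one>\<^bsub>H Mod S\<^esub>" if "p \<in> P" for p
    using that fPS S.subset by (auto simp: q FactGroup_def H.coset_join2 S.subgroup_axioms)
  then have "Z_trivial (G, P) (H Mod S, q ` Q) (compose (carrier G) q f)"
    using Psub by (subst Z_trivial_iff[OF preord_hom_compose[OF f q_mor]]) (auto simp: compose_def)
  moreover have "\<exists>!\<psi>. \<psi> \<in> preord_hom (H Mod S, q ` Q) Y \<and> compose (carrier H) \<psi> q = \<beta>"
    if \<beta>: "\<beta> \<in> preord_hom (H, Q) Y" and triv: "Z_trivial (G, P) Y (compose (carrier G) \<beta> f)"
    for Y :: "'y preord_grp" and \<beta>
  proof -
    obtain K R where Y: "Y = (K, R)" by (cases Y)
    have KR: "preord_group (K, R)"
      using \<beta> by (simp add: preord_hom_iff Y)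
    interpret \<beta>: group_hom H K \<beta>
      using \<beta> preord_groupD(1)[OF KR]
      by (simp add: preord_hom_iff Y group_hom_def group_hom_axioms_def H.group_axioms)
    have "\<beta> (f p) = \<one>\<^bsub>K\<^esub>" if "p \<in> P" for p
      using triv that Psub Z_trivial_iff[OF preord_hom_compose[OF f \<beta>[unfolded Y]]]
      by (auto simp: Y compose_def)
    then have "f ` P \<subseteq> kernel H K \<beta>"
      using fPQ Qsub by (auto simp: kernel_def)
    \<comment> \<open>The kernel is one of the normal subgroups over which the hull is
      intersected.\<close>
    then have "S \<subseteq> kernel H K \<beta>"
      unfolding S normal_closure_def using \<beta>.normal_kernel by (rule hull_minimal)
    then obtain \<phi> where \<phi>: "\<phi> \<in> hom (H Mod S) K"
      "\<And>h. h \<in> carrier H \<Longrightarrow> \<phi> (S #>\<^bsub>H\<^esub> h) = \<beta> h"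
      using \<beta>.FactGroup_universal_kernel[OF \<open>S \<lhd> H\<close>] by blast
    \<comment> \<open>The induced map \<open>\<phi>\<close> is arbitrary off the carrier;
      restricting it gives the extensional representative that \<open>preord_hom\<close>
      demands.\<close>
    define \<psi> where "\<psi> = restrict \<phi> (carrier (H Mod S))"
    have \<psi>q: "\<psi> (q h) = \<beta> h" if "h \<in> carrier H" for h
      using that \<phi>(2) q_carrier unfolding \<psi>_def q by auto
    have "\<psi> \<in> hom (H Mod S) K"
    proof (rule homI)
      fix X Z assume XZ: "X \<in> carrier (H Mod S)" "Z \<in> carrier (H Mod S)"
      then have "X \<otimes>\<^bsub>H Mod S\<^esub> Z \<in> carrier (H Mod S)"
        by (rule monoid.m_closed[OF group.is_monoid[OF S.factorgroup_is_group]])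
      then show "\<psi> (X \<otimes>\<^bsub>H Mod S\<^esub> Z) = \<psi> X \<otimes>\<^bsub>K\<^esub> \<psi> Z"
        using hom_mult[OF \<phi>(1) XZ] XZ unfolding \<psi>_def by (simp only: restrict_apply' )
    next
      fix X assume "X \<in> carrier (H Mod S)"
      then show "\<psi> X \<in> carrier K"
        using hom_in_carrier[OF \<phi>(1)] unfolding \<psi>_def by (simp only: restrict_apply')
    qed
    \<comment> \<open>Positive elements of the quotient are images \<open>q h\<close> with
      \<open>h \<in> Q\<close>, and \<open>\<psi>\<close> sends them to
      \<open>\<beta> h\<close>.\<close>
    moreover have "\<psi> ` q ` Q \<subseteq> R"
      using \<beta> \<psi>q Qsub by (auto simp: preord_hom_iff Y)
    ultimately have "\<psi> \<in> preord_hom (H Mod S, q ` Q) Y"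
      using HS KR by (simp add: preord_hom_iff Y \<psi>_def)
    moreover have "compose (carrier H) \<psi> q = \<beta>"
      using \<beta> \<psi>q by (intro ext) (auto simp: compose_def preord_hom_iff Y extensional_def)
    \<comment> \<open>Every element of the quotient is some \<open>q h\<close>, where both maps take
      the value \<open>\<beta> h\<close>; off the carrier extensionality decides.\<close>
    moreover have "\<psi>' = \<psi>"
      if "\<psi>' \<in> preord_hom (H Mod S, q ` Q) Y" "compose (carrier H) \<psi>' q = \<beta>" for \<psi>'
    proof (rule extensionalityI)
      show "\<psi>' \<in> extensional (carrier (H Mod S))"
        using that(1) by (simp add: preord_hom_iff Y)
      show "\<psi> \<in> extensional (carrier (H Mod S))"
        by (simp add: \<psi>_def)
      fix X assume "X \<in> carrier (H Mod S)"
      then obtain h where h: "h \<in> carrier H" "X = q h"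
        using q_carrier by blast
      then have "\<psi>' X = \<beta> h"
        using that(2) by (auto simp: compose_def)
      then show "\<psi>' X = \<psi> X"
        using h \<psi>q by simp
    qed
    ultimately show ?thesis by blast
  qed
  ultimately show ?thesis
    using f q_mor by (simp add: Z_cokernel_def)
qed

theorem proposition3p2:
  fixes G :: "'a monoid" and P\<^sub>G :: "'a set"
    and H :: "'b monoid" and P\<^sub>H :: "'b set"
    and f :: "'a \<Rightarrow> 'b" and S :: "'b set" and q :: "'b \<Rightarrow> 'b set"
  assumes f: "f \<in> preord_hom (G, P\<^sub>G) (H, P\<^sub>H)"
    and S: "S = normal_closure H (f ` P\<^sub>G)"
    and q: "q = (\<lambda>h\<in>carrier H. S #>\<^bsub>H\<^esub> h)"
  shows "S = {alt_prod H ss | ss. ss \<noteq> [] \<and> even (length ss) \<and>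
                (\<forall>s\<in>set ss. \<exists>h\<in>carrier H. \<exists>g\<in>P\<^sub>G. s = h \<otimes>\<^bsub>H\<^esub> f g \<otimes>\<^bsub>H\<^esub> inv\<^bsub>H\<^esub> h)} \<and>
         Z_cokernel TYPE('y) (G, P\<^sub>G) (H, P\<^sub>H) (H Mod S, q ` P\<^sub>H) f q"
proof
  have GP: "preord_group (G, P\<^sub>G)" and HP: "preord_group (H, P\<^sub>H)"
    and fhom: "f \<in> hom G H" and fP: "f ` P\<^sub>G \<subseteq> P\<^sub>H"
    using f by (auto simp: preord_hom_iff)
  interpret H: group H
    using HP by (rule preord_groupD)
  \<comment> \<open>The cone contains the identity, so its image does too; this is the padding
    letter for the word description.\<close>
  have "f \<one>\<^bsub>G\<^esub> = \<one>\<^bsub>H\<^esub>"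
    using fhom preord_groupD(1)[OF GP] H.group_axioms by (rule hom_one)
  then have "\<one>\<^bsub>H\<^esub> \<in> f ` P\<^sub>G"
    using preord_groupD(4)[OF GP] by force
  moreover have "f ` P\<^sub>G \<subseteq> carrier H"
    using fP preord_groupD(3)[OF HP] by blast
  ultimately show "S = {alt_prod H ss | ss. ss \<noteq> [] \<and> even (length ss) \<and>
      (\<forall>s\<in>set ss. \<exists>h\<in>carrier H. \<exists>g\<in>P\<^sub>G. s = h \<otimes>\<^bsub>H\<^esub> f g \<otimes>\<^bsub>H\<^esub> inv\<^bsub>H\<^esub> h)}"
    using H.normal_closure_eq_alt_prods[of "f ` P\<^sub>G"] by (simp add: S)
  show "Z_cokernel TYPE('y) (G, P\<^sub>G) (H, P\<^sub>H) (H Mod S, q ` P\<^sub>H) f q"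
    using f S q by (rule Z_cokernel_normal_closure)
qed

end
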